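(* Let $E_n(x)$ denote the Euler polynomials. The real zeros of $E_n(nx)$ falling in the line segment $\left[-\frac{1}{\pi e},\frac{1}{\pi e}\right]$ are uniformly distributed in this segment; that is, for all $-\frac{1}{\pi e}\le a<b\le\frac{1}{\pi e}$, $$\lim_{n\to\infty}\frac1n\,\#\{x\in[a,b]: E_n(nx)=0\}=b-a.$$ As a consequence, the fraction of zeros of $E_n(nx)$ residing in the segment $\left[-\frac{1}{\pi e},\frac{1}{\pi e}\right]$ is (asymptotically as $n\to\infty$) $\dfrac{2}{\pi e}$.
   Context: The Euler polynomials $E_n(x)$ are defined by $\dfrac{2e^{\xi x}}{e^{\xi}+1}=\sum_{n\ge 0}E_n(x)\dfrac{\xi^n}{n!}$; $E_n(nx)$ is regarded as a polynomial in $x$ of degree $n$. Zeros are counted with multiplicity. *)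

theory Defs
  imports "HOL-Analysis.Analysis" "HOL-Computational_Algebra.Computational_Algebra"
begin

text \<open>
  The sequence of Euler polynomials is the unique sequence of polynomials with exponential
  generating function \<open>2 e\<^sup>x\<^sup>\<xi> / (e\<^sup>\<xi> + 1)\<close>, an identity of formal power series in \<open>\<xi>\<close> for each
  \<open>x\<close>; existence and uniqueness are shown below. Coefficients are taken in the complex numbers
  so that all zeros are available.
\<close>

definition is_euler_polys :: "(nat \<Rightarrow> complex poly) \<Rightarrow> bool" where
  "is_euler_polys E \<longleftrightarrow>
     (\<forall>x. 2 * fps_exp x / (fps_exp 1 + 1) = Abs_fps (\<lambda>n. poly (E n) x / fact n))"

definition euler_poly :: "nat \<Rightarrow> complex poly" where
  "euler_poly = (THE E. is_euler_polys E)"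

lemma is_euler_polys_ex1: "\<exists>!E. is_euler_polys E"
proof (rule ex_ex1I)
  define c :: "complex fps" where "c = 2 * inverse (fps_exp 1 + 1)"
  define E where
    "E = (\<lambda>n. \<Sum>i=0..n. monom (fact n * fps_nth c i / fact (n - i)) (n - i))"
  have "2 * fps_exp x / (fps_exp 1 + 1) = Abs_fps (\<lambda>n. poly (E n) x / fact n)" for x
  proof -
    have "2 * fps_exp x / (fps_exp 1 + 1) = c * fps_exp x"
      by (simp add: c_def fps_divide_unit mult_ac)
    also have "\<dots> = Abs_fps (\<lambda>n. poly (E n) x / fact n)"
      by (rule fps_ext)
         (simp add: E_def fps_mult_nth poly_sum poly_monom sum_divide_distrib)
    finally show ?thesis .
  qed
  thus "\<exists>E. is_euler_polys E"
    unfolding is_euler_polys_def by blast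
next
  fix E F
  assume E: "is_euler_polys E" and F: "is_euler_polys F"
  show "E = F"
  proof
    fix n
    have "poly (E n) x = poly (F n) x" for x
    proof -
      have "Abs_fps (\<lambda>n. poly (E n) x / fact n) = Abs_fps (\<lambda>n. poly (F n) x / fact n)"
        using E F unfolding is_euler_polys_def by metis
      hence "fps_nth (Abs_fps (\<lambda>n. poly (E n) x / fact n)) n =
             fps_nth (Abs_fps (\<lambda>n. poly (F n) x / fact n)) n"
        by (rule arg_cong)
      thus ?thesis by simp
    qed
    thus "E n = F n"
      by (simp add: poly_eq_poly_eq_iff [symmetric] fun_eq_iff)
  qed
qed

lemma euler_poly_gf:
  "2 * fps_exp x / (fps_exp 1 + 1) = Abs_fps (\<lambda>n. poly (euler_poly n) x / fact n)"
proof -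
  have "is_euler_polys euler_poly"
    unfolding euler_poly_def by (rule theI' [OF is_euler_polys_ex1])
  thus ?thesis
    unfolding is_euler_polys_def by blast
qed

definition scaled_euler_poly :: "nat \<Rightarrow> complex poly" where
  "scaled_euler_poly n = pcompose (euler_poly n) [:0, of_nat n:]"

lemma poly_scaled_euler_poly:
  "poly (scaled_euler_poly n) x = poly (euler_poly n) (of_nat n * x)"
  by (simp add: scaled_euler_poly_def poly_pcompose mult.commute)

definition zeros_in :: "complex poly \<Rightarrow> complex set \<Rightarrow> complex multiset" where
  "zeros_in p S = filter_mset (\<lambda>z. z \<in> S) (proots p)"

end

theory Submission
  imports Defs "HOL-Complex_Analysis.Complex_Analysis"
begin

text \<open>
  Put \<open>R = 2.9 \<pi>\<close>, so that \<open>\<pi> e < R < 3 \<pi>\<close>. Since \<open>2 / (e\<^sup>\<xi> + 1)\<close> has only the simple poles \<open>\<plusminus>\<pi> i\<close>, both with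
  residue \<open>-2\<close>, in \<open>\<bar>\<xi>\<bar> < 3 \<pi>\<close>, its Taylor coefficients are those of the two pole terms up to
  \<open>O(R\<^sup>-\<^sup>k)\<close>. Convolving with the Taylor coefficients of \<open>e\<^sup>y\<^sup>\<xi>\<close>, the pole terms contribute a sine wave
  minus tails of exponential series, and the rest a partial sum of an exponential series. For
  \<open>\<bar>y\<bar> \<le> (n + 1) / (\<pi> e)\<close> both errors are, with \<open>N = n + 1\<close>, at most a constant times
  \<open>(N/e)\<^sup>N / N!\<close>, which tends to \<open>0\<close>. Hence, uniformly in such \<open>y\<close>,
  \<open>\<pi>\<^sup>n\<^sup>+\<^sup>1 E\<^sub>n(y) / (4 n!) = sin (\<pi> y - n \<pi> / 2) + o(1)\<close>,
  with no loss at the end points of the segment. As \<open>E\<^sub>n' = n E\<^sub>n\<^sub>-\<^sub>1\<close>, the derivative is likewise close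
  to \<open>\<pi>\<close> times the corresponding cosine. The sign changes of the sine give a zero in every unit step,
  and since the cosine is bounded away from \<open>0\<close> near the zeros of the sine, each zero is simple and, by
  Rolle's theorem, alone in its step.
\<close>

section \<open>Coefficients of the Euler polynomials\<close>

definition euler_coeff :: "nat \<Rightarrow> complex" where
  "euler_coeff = fps_nth (2 * inverse (fps_exp 1 + 1))"

lemma coeff_euler_poly:
  "coeff (euler_poly n) j = (if j \<le> n then fact n * euler_coeff (n - j) / fact j else 0)"
proof -
  define p where "p = (\<Sum>i\<le>n. monom (fact n * euler_coeff i / fact (n - i)) (n - i))"
  have "poly (euler_poly n) x = poly p x" for x
  proof -
    have "2 * fps_exp x / (fps_exp 1 + 1) = (2 * inverse (fps_exp 1 + 1)) * fps_exp x"
      by (simp add: fps_divide_unit mult_ac)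
    then have "poly (euler_poly n) x / fact n = fps_nth ((2 * inverse (fps_exp 1 + 1)) * fps_exp x) n"
      by (metis euler_poly_gf fps_nth_Abs_fps)
    also have "\<dots> = (\<Sum>i=0..n. euler_coeff i * (x ^ (n - i) / fact (n - i)))"
      by (simp only: fps_mult_nth euler_coeff_def fps_exp_nth of_nat_fact)
    finally show ?thesis
      by (simp add: p_def poly_sum poly_monom field_simps sum_distrib_left sum_distrib_right
                    atMost_atLeast0)
  qed
  then have "euler_poly n = p"
    by (simp add: poly_eq_poly_eq_iff [symmetric] fun_eq_iff)
  moreover have "coeff p j = (if j \<le> n then fact n * euler_coeff (n - j) / fact j else 0)"
  proof (cases "j \<le> n")
    case True
    then have "coeff p j = (\<Sum>i\<le>n. if i = n - j then fact n * euler_coeff i / fact (n - i) else 0)"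
      unfolding p_def coeff_sum by (intro sum.cong) auto
    with True show ?thesis
      by simp
  qed (auto simp: p_def coeff_sum intro!: sum.neutral)
  ultimately show ?thesis
    by simp
qed

lemma euler_coeff_0: "euler_coeff 0 = 1"
  by (simp add: euler_coeff_def)

text \<open>Multiplying the series by \<open>fps_exp 1 + 1\<close> gives \<open>2\<close>; comparing
  coefficients expresses \<open>euler_coeff n\<close> through the earlier ones by real operations.
  Reality is what later admits Rolle's theorem and the intermediate value theorem.\<close>

lemma euler_coeff_Real: "euler_coeff n \<in> \<real>"
proof (induction n rule: less_induct)
  case (less n)
  have "2 * inverse (fps_exp 1 + 1) * (fps_exp 1 + 1) = (2 :: complex fps)"
    by (subst mult.assoc, subst inverse_mult_eq_1) auto
  then have "(\<Sum>i=0..n. euler_coeff i * fps_nth (fps_exp 1 + 1) (n - i)) = fps_nth 2 n"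
    unfolding euler_coeff_def by (metis fps_mult_nth)
  then have "2 * euler_coeff n =
      fps_nth 2 n - (\<Sum>i=0..<n. euler_coeff i * fps_nth (fps_exp 1 + 1) (n - i))"
    by (simp add: atLeastLessThanSuc_atLeastAtMost [symmetric] algebra_simps)
  also have "\<dots> \<in> \<real>"
  proof -
    have "fps_nth (2 :: complex fps) n \<in> \<real>"
      by (cases n) (auto simp: numeral_fps_const)
    moreover have "fps_nth (fps_exp 1 + 1 :: complex fps) m \<in> \<real>" for m
      by (auto intro!: Reals_add Reals_divide) (metis Reals_of_nat of_nat_fact)+
    ultimately show ?thesis
      using less by (intro Reals_diff sum_in_Reals Reals_mult) (simp_all del: fps_add_nth fps_exp_nth)
  qed
  finally have "2 * euler_coeff n \<in> \<real>" .
  then have "2 * euler_coeff n / 2 \<in> \<real>"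
    by (rule Reals_divide) simp
  then show ?case
    by simp
qed

lemma pderiv_euler_poly: "pderiv (euler_poly (Suc n)) = smult (of_nat (Suc n)) (euler_poly n)"
  by (rule poly_eqI) (simp add: coeff_pderiv coeff_euler_poly field_simps del: of_nat_Suc)

lemma degree_euler_poly: "degree (euler_poly n) = n"
proof (rule antisym)
  show "degree (euler_poly n) \<le> n"
    by (rule degree_le) (simp add: coeff_euler_poly)
  show "n \<le> degree (euler_poly n)"
    by (rule le_degree) (simp add: coeff_euler_poly euler_coeff_0)
qed

lemma poly_euler_poly:
  "poly (euler_poly n) x = fact n * (\<Sum>j\<le>n. euler_coeff (n - j) * x ^ j / fact j)"
  by (simp add: poly_altdef degree_euler_poly coeff_euler_poly sum_distrib_left mult_ac)

section \<open>Poles of the generating function and asymptotics of its coefficients\<close>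

text \<open>Near \<open>a\<close>, \<open>exp z + 1 = exp z - exp a\<close> behaves like
  \<open>-(z - a)\<close>, so \<open>2 / (z - a)\<close> cancels the pole. The term
  \<open>2 / (z + a)\<close> is regular there; it makes the expression symmetric, so that the lemma
  serves \<open>a\<close> and \<open>-a\<close> alike.\<close>

lemma exp_plus_1_simple_pole:
  fixes a :: complex
  assumes "exp a = -1" "a \<noteq> 0"
  shows "((\<lambda>z. (z - a) * (2 / (exp z + 1) + 2 / (z - a) + 2 / (z + a))) \<longlongrightarrow> 0) (at a)"
proof -
  have "(exp has_field_derivative exp a) (at a)"
    by (rule DERIV_exp)
  then have "((\<lambda>z. (exp z - exp a) / (z - a)) \<longlongrightarrow> exp a) (at a)"
    by (simp add: has_field_derivative_iff)
  then have "((\<lambda>z. 2 * inverse ((exp z - exp a) / (z - a)) + 2 + 2 * (z - a) / (z + a))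
      \<longlongrightarrow> 2 * inverse (exp a) + 2 + 2 * (a - a) / (a + a)) (at a)"
    using assms by (intro tendsto_intros) auto
  also have "2 * inverse (exp a) + 2 + 2 * (a - a) / (a + a) = 0"
    using assms by simp
  finally show ?thesis
    by (rule Lim_transform_eventually)
       (auto simp: eventually_at_filter assms field_simps intro!: always_eventually)
qed

text \<open>The solutions are the odd multiples of \<open>pi * \<i>\<close>; the next ones after
  these two have modulus \<open>3 * pi\<close>.\<close>

lemma exp_eq_minus_1_ball:
  fixes z :: complex
  assumes "exp z = -1" "norm z < 3 * pi"
  shows "z = pi * \<i> \<or> z = - (pi * \<i>)"
proof -
  have "exp z = exp (pi * \<i>)"
    using assms by simp
  then obtain n :: int where n: "z = pi * \<i> + (of_int (2 * n) * pi) * \<i>"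
    by (auto simp only: exp_eq)
  then have z: "z = of_real ((2 * of_int n + 1) * pi) * \<i>"
    by (simp add: algebra_simps)
  have "norm z = \<bar>2 * of_int n + 1\<bar> * pi"
    unfolding z norm_mult norm_of_real by (simp add: abs_mult)
  with assms have "\<bar>2 * real_of_int n + 1\<bar> * pi < 3 * pi"
    by simp
  then have "\<bar>2 * real_of_int n + 1\<bar> < 3"
    by simp
  then have "n = 0 \<or> n = -1"
    by linarith
  then show ?thesis
    using z by auto
qed

text \<open>Once both poles are cancelled, the generating function extends holomorphically to the
  disc of radius \<open>3 * pi\<close>, so the Taylor coefficients of the extension, multiplied by
  \<open>R ^ k\<close>, stay bounded.\<close>

lemma euler_coeff_asymp:
  assumes "0 < R" "R < 3 * pi"
  obtains C where
    "\<And>k. norm (euler_coeff k - 2 / (pi * \<i>) ^ Suc k - 2 / (- (pi * \<i>)) ^ Suc k) \<le> C / R ^ k"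
proof -
  define a :: complex where "a = pi * \<i>"
  define h where "h = (\<lambda>z. 2 / (exp z + 1) + 2 / (z - a) + 2 / (z + a))"
  define B where "B = ball (0 :: complex) (3 * pi)"
  have a: "exp a = -1" "exp (-a) = -1" "a \<noteq> 0" "norm a = pi"
    by (simp_all add: a_def exp_minus norm_mult)
  have aB: "a \<in> B" "-a \<in> B" "open B"
    by (auto simp: B_def a)
  \<comment> \<open>The singularities are removed one after the other: \<open>g\<close> extends
    \<open>h\<close> over \<open>-a\<close>, then \<open>G\<close> extends \<open>g\<close> over
    \<open>a\<close>.\<close>
  have "h holomorphic_on B - {a} - {-a}"
    unfolding h_def
  proof (intro holomorphic_intros)
    fix z assume z: "z \<in> B - {a} - {- a}"
    then show "exp z + 1 \<noteq> 0"
      using exp_eq_minus_1_ball [of z] by (auto simp: B_def a_def add_eq_0_iff2)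
    show "z - a \<noteq> 0" "z + a \<noteq> 0"
      using z by (auto simp: add_eq_0_iff2)
  qed
  moreover have "((\<lambda>z. (z - (-a)) * h z) \<longlongrightarrow> 0) (at (-a))"
    using exp_plus_1_simple_pole [of "-a"] a by (simp add: h_def algebra_simps)
  moreover have "-a \<in> interior (B - {a})"
    using aB a by (subst interior_open) auto
  ultimately obtain g where g: "g holomorphic_on B - {a}" "\<And>z. z \<in> B - {a} - {-a} \<Longrightarrow> g z = h z"
    using holomorphic_on_extend_lim [of h "B - {a}" "-a"] by auto
  have "((\<lambda>z. (z - a) * h z) \<longlongrightarrow> 0) (at a)"
    using exp_plus_1_simple_pole [of a] a by (simp add: h_def)
  moreover have "\<forall>\<^sub>F z in at a. (z - a) * h z = (z - a) * g z"
  proof -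
    have "\<forall>\<^sub>F z in at a. z \<in> B - {-a} - {a}"
      using aB a by (intro eventually_at_in_open) auto
    then show ?thesis
      by eventually_elim (use g(2) in auto)
  qed
  ultimately have "((\<lambda>z. (z - a) * g z) \<longlongrightarrow> 0) (at a)"
    by (rule Lim_transform_eventually)
  moreover have "a \<in> interior B"
    using aB by (subst interior_open) auto
  ultimately obtain G where G: "G holomorphic_on B" "\<And>z. z \<in> B - {a} \<Longrightarrow> G z = g z"
    using holomorphic_on_extend_lim [of g B a] g by auto
  \<comment> \<open>The same function as a formal series. It is the expansion of \<open>G\<close> at
    0, so holomorphy of \<open>G\<close> on \<open>B\<close> bounds its radius of convergence from
    below.\<close>
  define H where "H = 2 * inverse (fps_exp 1 + 1) + 2 * inverse (fps_X - fps_const a)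
                      + 2 * inverse (fps_X + fps_const a)"
  have "(\<lambda>z. 2 * inverse (exp z + 1) + 2 * inverse (z - a) + 2 * inverse (z + a)) has_fps_expansion H"
    unfolding H_def by (intro fps_expansion_intros) (auto simp: a)
  moreover have "\<forall>\<^sub>F z in nhds 0. 2 * inverse (exp z + 1) + 2 * inverse (z - a) + 2 * inverse (z + a) = G z"
  proof -
    have "\<forall>\<^sub>F z in nhds 0. z \<in> B - {a} - {-a}"
      using a aB by (intro eventually_nhds_in_open) (auto simp: B_def)
    then show ?thesis
      by eventually_elim (use G g in \<open>auto simp: h_def divide_inverse\<close>)
  qed
  ultimately have GH: "G has_fps_expansion H"
    by (rule has_fps_expansion_cong [THEN iffD1, OF _ refl, rotated])
  have "ereal (3 * pi) \<le> fps_conv_radius H"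
    using holomorphic_on_imp_fps_conv_radius_ge [OF GH, of "3 * pi"] G by (simp add: B_def)
  then have "summable (\<lambda>n. fps_nth H n * of_real R ^ n)"
    using assms by (intro summable_fps) (auto elim: less_le_trans [rotated])
  then have "bounded (range (\<lambda>n. fps_nth H n * of_real R ^ n))"
    by (intro convergent_imp_bounded) (rule summable_LIMSEQ_zero)
  then obtain C where C: "\<And>n. norm (fps_nth H n * of_real R ^ n) \<le> C"
    by (auto simp: bounded_iff)
  \<comment> \<open>The geometric series, used with \<open>c = -a\<close> and \<open>c = a\<close>
    to read off the two pole terms.\<close>
  have inv: "inverse (fps_X + fps_const c) = Abs_fps (\<lambda>n. - inverse ((- c) ^ Suc n))"
    if "c \<noteq> 0" for c :: complex
  proof (rule fps_inverse_unique)
    show "(fps_X + fps_const c) * Abs_fps (\<lambda>n. - inverse ((- c) ^ Suc n)) = 1"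
    proof (rule fps_ext)
      fix n show "((fps_X + fps_const c) * Abs_fps (\<lambda>n. - inverse ((- c) ^ Suc n))) $ n = 1 $ n"
        using that by (cases n) (auto simp: distrib_right field_simps)
    qed
  qed
  have "fps_nth H k = euler_coeff k - 2 / a ^ Suc k - 2 / (- a) ^ Suc k" for k
  proof -
    have "fps_X - fps_const a = fps_X + fps_const (-a)"
      by (simp flip: fps_const_neg)
    then have "H = 2 * inverse (fps_exp 1 + 1) + 2 * Abs_fps (\<lambda>n. - inverse (a ^ Suc n))
                 + 2 * Abs_fps (\<lambda>n. - inverse ((- a) ^ Suc n))"
      using inv [of a] inv [of "-a"] a(3) by (simp only: H_def) simp
    then show ?thesis
      by (simp add: euler_coeff_def numeral_fps_const divide_inverse del: power_Suc)
  qed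
  moreover have "norm (fps_nth H k) \<le> C / R ^ k" for k
    using C [of k] assms by (simp add: norm_mult norm_power field_simps)
  ultimately show thesis
    using that unfolding a_def by metis
qed

section \<open>Decay of the error scale\<close>

text \<open>The probability that a Poisson variable of mean \<open>N\<close> takes the value
  \<open>N\<close>. All errors below are measured in it.\<close>

definition poisson_peak :: "nat \<Rightarrow> real" where
  "poisson_peak N = (real N / exp 1) ^ N / fact N"

lemma fact_add_le: "fact (N + i) \<le> fact N * real (N + m) ^ i" if "i \<le> m"
  using that
proof (induction i)
  case (Suc i)
  have "fact (N + Suc i) = real (N + Suc i) * fact (N + i)"
    by simp
  also have "\<dots> \<le> real (N + m) * (fact N * real (N + m) ^ i)"
    using Suc by (intro mult_mono) auto
  finally show ?case
    by (simp add: mult_ac)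
qed auto

text \<open>The \<open>m\<close> terms of the series for \<open>exp N\<close> following the largest one are all comparable to it.\<close>
lemma poisson_peak_le:
  assumes "m > 0" "N > 0"
  shows "poisson_peak N \<le> (1 + real m / real N) ^ m / real m"
proof -
  \<comment> \<open>For \<open>N \<le> j < N + m\<close> the terms \<open>N ^ j / j!\<close> have
    consecutive ratio \<open>N / (j + 1)\<close>, which is at least \<open>q\<close>.\<close>
  define q where "q = real N / real (N + m)"
  have q: "0 < q" "q \<le> 1"
    using assms by (auto simp: q_def)
  have "real m * (real N ^ N / fact N * q ^ m) = (\<Sum>i<m. real N ^ N / fact N * q ^ m)"
    by simp
  also have "\<dots> \<le> (\<Sum>i<m. real N ^ (N + i) / fact (N + i))"
  proof (rule sum_mono)
    fix i assume "i \<in> {..<m}"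
    then have i: "i \<le> m"
      by simp
    have "real N ^ N / fact N * q ^ m \<le> real N ^ N / fact N * q ^ i"
      using q i by (intro mult_left_mono power_decreasing) auto
    also have "\<dots> = real N ^ (N + i) / (fact N * real (N + m) ^ i)"
      by (simp add: q_def power_add power_divide)
    also have "\<dots> \<le> real N ^ (N + i) / fact (N + i)"
      using fact_add_le [OF i, of N] assms(2) by (intro divide_left_mono mult_pos_pos zero_less_power) auto
    finally show "real N ^ N / fact N * q ^ m \<le> real N ^ (N + i) / fact (N + i)" .
  qed
  also have "\<dots> = (\<Sum>j\<in>(+) N ` {..<m}. real N ^ j / fact j)"
    by (subst sum.reindex) auto
  also have "\<dots> \<le> (\<Sum>j. real N ^ j / fact j)"
    using summable_exp [of "real N"]
    by (intro sum_le_suminf) (auto simp: divide_inverse mult.commute)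
  also have "\<dots> = exp (real N)"
    by (simp add: exp_def divide_inverse mult.commute)
  finally have "real m * (real N ^ N / fact N * q ^ m) \<le> exp 1 ^ N"
    by (simp flip: exp_of_nat_mult)
  then have "poisson_peak N \<le> 1 / q ^ m / real m"
    using q assms by (simp add: poisson_peak_def field_simps)
  also have "1 / q = 1 + real m / real N"
    using assms by (simp add: q_def field_simps)
  then have "1 / q ^ m = (1 + real m / real N) ^ m"
    by (metis power_one_over)
  finally show ?thesis .
qed

lemma poisson_peak_nonneg: "poisson_peak N \<ge> 0"
  by (simp add: poisson_peak_def)

text \<open>For fixed \<open>m\<close> the bound of \<open>poisson_peak_le\<close> tends to
  \<open>1 / m\<close>, and \<open>m\<close> is arbitrary.\<close>

lemma poisson_peak_tendsto_0: "poisson_peak \<longlonglongrightarrow> 0"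
proof (rule order_tendstoI)
  fix e :: real assume "0 < e"
  then obtain m where m: "m > 0" "1 / real m < e"
    using nat_approx_posE [of e] by (metis zero_less_Suc)
  have "(\<lambda>N. (1 + real m / real N) ^ m / real m) \<longlonglongrightarrow> (1 + 0) ^ m / real m"
    using m by (intro tendsto_intros lim_const_over_n) auto
  then have "\<forall>\<^sub>F N in sequentially. (1 + real m / real N) ^ m / real m < e"
    using m by (intro order_tendstoD(2)) auto
  then show "\<forall>\<^sub>F N in sequentially. poisson_peak N < e"
    using eventually_gt_at_top [of 0]
    by eventually_elim (rule le_less_trans [OF poisson_peak_le [OF m(1)]])
next
  fix e :: real assume "e < 0"
  then show "\<forall>\<^sub>F N in sequentially. e < poisson_peak N"
    by (intro always_eventually allI less_le_trans [OF _ poisson_peak_nonneg])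
qed

section \<open>Tails and partial sums of the exponential series\<close>

text \<open>From index \<open>N\<close> on, consecutive terms have ratio at most \<open>q\<close> in
  modulus, so a geometric series started at the first omitted term dominates the tail.\<close>

lemma exp_remainder_le:
  fixes w :: complex
  assumes "norm w \<le> q * real N" "0 \<le> q" "q < 1"
  shows "norm (exp w - (\<Sum>j<N. w ^ j / fact j)) \<le> norm w ^ N / fact N / (1 - q)"
proof -
  have step: "norm w ^ (i + N) / fact (i + N) \<le> norm w ^ N / fact N * q ^ i" for i
  proof (induction i)
    case (Suc i)
    have "norm w / real (Suc i + N) \<le> q"
      using assms mult_left_mono [of "real N" "real (Suc i + N)" q]
      by (simp add: divide_le_eq del: of_nat_Suc of_nat_add)
    then have "(norm w ^ (i + N) / fact (i + N)) * (norm w / real (Suc i + N)) \<le>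
        (norm w ^ N / fact N * q ^ i) * q"
      using Suc assms by (intro mult_mono) auto
    then show ?case
      by (simp add: mult_ac)
  qed auto
  have "(\<lambda>j. w ^ j / fact j) sums exp w"
    using exp_converges [of w] by (simp add: scaleR_conv_of_real divide_inverse mult.commute)
  then have sums: "(\<lambda>i. w ^ (i + N) / fact (i + N)) sums (exp w - (\<Sum>j<N. w ^ j / fact j))"
    by (rule sums_split_initial_segment)
  have geo: "(\<lambda>i. norm w ^ N / fact N * q ^ i) sums (norm w ^ N / fact N * (1 / (1 - q)))"
    using assms by (intro sums_mult geometric_sums) auto
  have "norm (\<Sum>i. w ^ (i + N) / fact (i + N)) \<le> (\<Sum>i. norm w ^ N / fact N * q ^ i)"
    using step geo by (intro norm_suminf_le) (auto simp: norm_divide norm_power norm_mult sums_iff)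
  then show ?thesis
    using sums geo by (simp add: sums_iff)
qed

text \<open>Up to index \<open>n\<close> the terms grow by a factor of at least \<open>l\<close>
  each time, so the sum is dominated by a geometric series running down from the last term.\<close>

lemma exp_partial_sum_le:
  fixes x :: real
  assumes "1 < l" "l * real n \<le> x"
  shows "(\<Sum>j\<le>n. x ^ j / fact j) \<le> l / (l - 1) * (x ^ n / fact n)"
  using assms(2)
proof (induction n)
  case 0
  then show ?case
    using assms(1) by (simp add: field_simps)
next
  case (Suc n)
  have x: "x > 0" and le: "l * real n \<le> x"
    using Suc.prems assms(1) by (auto simp: algebra_simps intro: less_le_trans)
       (use mult_nonneg_nonneg [of l "real n"] in linarith)
  have "real (Suc n) / x \<le> 1 / l"
    using Suc.prems x assms(1) by (simp add: field_simps)
  have "x ^ n / fact n = x ^ Suc n / fact (Suc n) * (real (Suc n) / x)"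
    using x by simp
  also have "\<dots> \<le> x ^ Suc n / fact (Suc n) * (1 / l)"
    using x \<open>real (Suc n) / x \<le> 1 / l\<close> by (intro mult_left_mono) auto
  finally have step: "x ^ n / fact n \<le> x ^ Suc n / fact (Suc n) * (1 / l)" .
  have "(\<Sum>j\<le>Suc n. x ^ j / fact j) \<le> l / (l - 1) * (x ^ n / fact n) + x ^ Suc n / fact (Suc n)"
    using Suc.IH [OF le] by simp
  also have "\<dots> \<le> l / (l - 1) * (x ^ Suc n / fact (Suc n) * (1 / l)) + x ^ Suc n / fact (Suc n)"
    using assms(1) step by (intro add_right_mono mult_left_mono) auto
  also have "\<dots> = l / (l - 1) * (x ^ Suc n / fact (Suc n))"
    using assms(1) by (simp add: divide_simps) (simp add: algebra_simps)
  finally show ?case .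
qed

section \<open>Uniform sine asymptotics of the Euler polynomials\<close>

text \<open>Convolving the pole coefficients with the series of \<open>exp (y * \<xi>)\<close> gives
  a partial sum of \<open>exp (a * y)\<close> divided by \<open>a ^ Suc n\<close>. As
  \<open>norm (a * y)\<close> is at most \<open>Suc n / e\<close>, the tail estimate applies with
  \<open>q = exp (-1)\<close>, and its leading term is at most
  \<open>poisson_peak (Suc n)\<close>.\<close>

lemma pole_part_asymp:
  fixes a :: complex and y :: real
  assumes "norm a = pi" "\<bar>y\<bar> \<le> real (Suc n) / (pi * exp 1)"
  shows "norm (pi ^ Suc n * (\<Sum>j\<le>n. 1 / a ^ Suc (n - j) * of_real y ^ j / fact j)
            - pi ^ Suc n / a ^ Suc n * exp (a * y)) \<le> poisson_peak (Suc n) / (1 - exp (-1))"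
proof -
  have "a \<noteq> 0"
    using assms by auto
  have "(\<Sum>j\<le>n. 1 / a ^ Suc (n - j) * of_real y ^ j / fact j) =
        (\<Sum>j\<le>n. 1 / a ^ Suc n * ((a * y) ^ j / fact j))"
  proof (rule sum.cong)
    fix j assume "j \<in> {..n}"
    then have "a ^ Suc n = a ^ Suc (n - j) * a ^ j"
      by (simp flip: power_add)
    then show "1 / a ^ Suc (n - j) * of_real y ^ j / fact j = 1 / a ^ Suc n * ((a * y) ^ j / fact j)"
      using \<open>a \<noteq> 0\<close> by (simp add: power_mult_distrib del: power_Suc)
  qed auto
  then have "pi ^ Suc n * (\<Sum>j\<le>n. 1 / a ^ Suc (n - j) * of_real y ^ j / fact j)
      - pi ^ Suc n / a ^ Suc n * exp (a * y)
    = - (pi ^ Suc n / a ^ Suc n) * (exp (a * y) - (\<Sum>j<Suc n. (a * y) ^ j / fact j))"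
    by (simp only: flip: sum_distrib_left lessThan_Suc_atMost) (simp add: algebra_simps)
  then have "norm (pi ^ Suc n * (\<Sum>j\<le>n. 1 / a ^ Suc (n - j) * of_real y ^ j / fact j)
      - pi ^ Suc n / a ^ Suc n * exp (a * y))
    = norm (exp (a * y) - (\<Sum>j<Suc n. (a * y) ^ j / fact j))"
    using assms(1) by (simp add: norm_mult norm_divide norm_power del: sum.lessThan_Suc power_Suc)
  also have ay: "norm (a * y) \<le> exp (-1) * real (Suc n)"
    using assms by (simp add: norm_mult exp_minus field_simps)
  then have "norm (exp (a * y) - (\<Sum>j<Suc n. (a * y) ^ j / fact j)) \<le>
      norm (a * y) ^ Suc n / fact (Suc n) / (1 - exp (-1))"
    by (intro exp_remainder_le) auto
  also have "\<dots> \<le> (exp (-1) * real (Suc n)) ^ Suc n / fact (Suc n) / (1 - exp (-1))"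
    using ay by (intro divide_right_mono power_mono) auto
  also have "\<dots> = poisson_peak (Suc n) / (1 - exp (-1))"
    by (simp add: poisson_peak_def exp_minus field_simps)
  finally show ?thesis .
qed

text \<open>The range of \<open>y\<close> makes the sum at most \<open>C / R ^ n\<close> times a
  partial exponential sum at \<open>l * Suc n\<close>. This argument exceeds \<open>l * n\<close>,
  so the last term governs, and its \<open>l ^ n\<close> cancels the one in
  \<open>R ^ n\<close>.\<close>

lemma analytic_part_bound:
  assumes "l > 1" "R = l * (pi * exp 1)" "\<And>k. norm (d k) \<le> C / R ^ k"
    "\<bar>y\<bar> \<le> real (Suc n) / (pi * exp 1)"
  shows "norm (pi ^ Suc n * (\<Sum>j\<le>n. d (n - j) * complex_of_real y ^ j / fact j))
    \<le> C * l / (l - 1) * pi * exp 1 * poisson_peak (Suc n)"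
proof -
  have R: "R > 0"
    using assms by simp
  have "C \<ge> 0"
    using assms(3) [of 0] order_trans [OF norm_ge_zero] by fastforce
  have "norm (\<Sum>j\<le>n. d (n - j) * complex_of_real y ^ j / fact j) \<le>
      (\<Sum>j\<le>n. C / R ^ n * ((l * real (Suc n)) ^ j / fact j))"
  proof (rule sum_norm_le)
    fix j assume "j \<in> {..n}"
    then have n: "R ^ n = R ^ (n - j) * R ^ j"
      by (simp flip: power_add)
    have "norm (d (n - j) * complex_of_real y ^ j / fact j) \<le> C / R ^ (n - j) * \<bar>y\<bar> ^ j / fact j"
      unfolding norm_divide norm_mult norm_power norm_of_real norm_fact
      by (intro divide_right_mono mult_right_mono assms(3)) auto
    also have "\<dots> \<le> C / R ^ (n - j) * (real (Suc n) / (pi * exp 1)) ^ j / fact j"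
      using assms(4) R \<open>C \<ge> 0\<close>
      by (intro divide_right_mono mult_left_mono power_mono) auto
    also have "real (Suc n) / (pi * exp 1) = l * real (Suc n) / R"
      using assms(1) by (simp add: assms(2))
    also have "C / R ^ (n - j) * (l * real (Suc n) / R) ^ j / fact j =
        C / R ^ n * ((l * real (Suc n)) ^ j / fact j)"
      using R by (simp add: n power_divide)
    finally show "norm (d (n - j) * complex_of_real y ^ j / fact j) \<le>
        C / R ^ n * ((l * real (Suc n)) ^ j / fact j)" .
  qed
  also have "\<dots> = C / R ^ n * (\<Sum>j\<le>n. (l * real (Suc n)) ^ j / fact j)"
    by (simp add: sum_distrib_left)
  also have "\<dots> \<le> C / R ^ n * (l / (l - 1) * ((l * real (Suc n)) ^ n / fact n))"
    using assms(1) \<open>C \<ge> 0\<close> R by (intro mult_left_mono exp_partial_sum_le) auto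
  also have "\<dots> = C * l / (l - 1) * ((real (Suc n) / (pi * exp 1)) ^ n / fact n)"
    using assms(1) by (simp add: assms(2) power_mult_distrib power_divide mult_ac del: of_nat_Suc)
  \<comment> \<open>One factor \<open>Suc n\<close> cancels between power and factorial, which
    leaves a single surplus factor \<open>exp 1\<close>.\<close>
  also have "(real (Suc n) / (pi * exp 1)) ^ n / fact n = exp 1 * poisson_peak (Suc n) / pi ^ n"
    by (simp add: poisson_peak_def power_mult_distrib power_divide field_simps del: of_nat_Suc)
  finally have "pi ^ Suc n * norm (\<Sum>j\<le>n. d (n - j) * complex_of_real y ^ j / fact j) \<le>
      pi ^ Suc n * (C * l / (l - 1) * (exp 1 * poisson_peak (Suc n) / pi ^ n))"
    by (intro mult_left_mono) auto
  then show ?thesis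
    by (simp add: norm_mult norm_power mult_ac)
qed

text \<open>The prefactors are powers of \<open>1 / \<i>\<close> and \<open>-1 / \<i>\<close>, that
  is, quarter turns. The two summands are thus conjugate points of the unit circle and add up to
  twice a cosine.\<close>

lemma pole_parts_eq_sin:
  fixes a :: complex and y :: real
  defines "a \<equiv> pi * \<i>"
  shows "pi ^ Suc n / a ^ Suc n * exp (a * y) + pi ^ Suc n / (- a) ^ Suc n * exp (- a * y)
    = 2 * complex_of_real (sin (pi * y - real n * pi / 2))"
proof -
  define t where "t = pi * y - real (Suc n) * pi / 2"
  have "pi ^ Suc n / a ^ Suc n * exp (a * y) = cis t"
  proof -
    have "pi ^ Suc n / a ^ Suc n = inverse (\<i> ^ Suc n)"
      by (simp add: a_def power_mult_distrib field_simps)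
    also have "\<i> ^ Suc n = cis (real (Suc n) * pi / 2)"
      using Complex.DeMoivre [of "pi / 2" "Suc n"] by (simp del: power_Suc)
    finally show ?thesis
      by (simp add: t_def a_def cis_conv_exp flip: exp_minus exp_add) (simp add: algebra_simps)
  qed
  moreover have "pi ^ Suc n / (- a) ^ Suc n * exp (- a * y) = cis (- t)"
  proof -
    have "- a = - \<i> * pi"
      by (simp add: a_def)
    then have "pi ^ Suc n / (- a) ^ Suc n = inverse ((- \<i>) ^ Suc n)"
      by (simp only: power_mult_distrib) (simp add: inverse_eq_divide del: power_Suc)
    also have "(- \<i>) ^ Suc n = cis (- (real (Suc n) * pi / 2))"
      using Complex.DeMoivre [of "- (pi / 2)" "Suc n"] by (simp del: power_Suc)
    finally show ?thesis
      by (simp add: t_def a_def cis_conv_exp flip: exp_minus exp_add) (simp add: algebra_simps)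
  qed
  moreover have "cis t + cis (- t) = 2 * complex_of_real (cos t)"
    by (simp add: complex_eq_iff)
  moreover have "cos t = sin (pi * y - real n * pi / 2)"
  proof -
    have "t = (pi * y - real n * pi / 2) - pi / 2"
      by (simp add: t_def field_simps)
    then show ?thesis
      by (simp add: cos_diff)
  qed
  ultimately show ?thesis
    by metis
qed

lemma euler_poly_asymp:
  "\<exists>K. \<forall>n y. \<bar>y\<bar> \<le> real (Suc n) / (pi * exp 1) \<longrightarrow>
    norm (complex_of_real (pi ^ Suc n / (4 * fact n)) * poly (euler_poly n) (complex_of_real y)
      - complex_of_real (sin (pi * y - real n * pi / 2))) \<le> K * poisson_peak (Suc n)"
proof -
  define a :: complex where "a = pi * \<i>"
  \<comment> \<open>Chosen so that \<open>R\<close> is \<open>2.9 * pi\<close>, which is below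
    \<open>3 * pi\<close>, while \<open>e < 2.72\<close> still gives \<open>l > 1\<close>.\<close>
  define l where "l = 29 / 10 / exp (1 :: real)"
  define R where "R = l * (pi * exp 1)"
  have l: "l > 1"
    using e_less_272 by (simp add: l_def)
  have R: "0 < R" "R < 3 * pi"
    using l by (auto simp: R_def) (simp add: l_def)
  obtain C where C: "\<And>k. norm (euler_coeff k - 2 / a ^ Suc k - 2 / (- a) ^ Suc k) \<le> C / R ^ k"
    using euler_coeff_asymp [OF R] unfolding a_def by blast
  define d where "d = (\<lambda>k. euler_coeff k - 2 / a ^ Suc k - 2 / (- a) ^ Suc k)"
  \<comment> \<open>Two pole tails, each with coefficient 2, and the analytic part. The division by
    4 undoes the amplitude: coefficient 2 at each pole times the 2 in
    \<open>cis t + cis (- t) = 2 * cos t\<close>.\<close>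
  define K where "K = (2 / (1 - exp (-1)) + 2 / (1 - exp (-1)) + C * l / (l - 1) * pi * exp 1) / 4"
  show ?thesis
  proof (intro exI [of _ K] allI impI)
    fix n and y :: real
    assume y: "\<bar>y\<bar> \<le> real (Suc n) / (pi * exp 1)"
    define S where "S = (\<lambda>c :: complex. \<Sum>j\<le>n. 1 / c ^ Suc (n - j) * complex_of_real y ^ j / fact j)"
    define D where "D = (\<Sum>j\<le>n. d (n - j) * complex_of_real y ^ j / fact j)"
    define T where "T = (\<lambda>c :: complex. pi ^ Suc n / c ^ Suc n * exp (c * complex_of_real y))"
    define P where "P = complex_of_real (pi ^ Suc n)"
    have "euler_coeff k = d k + 2 * (1 / a ^ Suc k) + 2 * (1 / (- a) ^ Suc k)" for k
      by (simp add: d_def)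
    then have "poly (euler_poly n) (complex_of_real y) = fact n * (2 * S a + 2 * S (- a) + D)"
      unfolding poly_euler_poly S_def D_def sum_distrib_left sum.distrib [symmetric]
      by (intro sum.cong arg_cong2 [of _ _ _ _ "(*)"] refl)
         (simp only: distrib_right add_divide_distrib, simp)
    then have "4 * (complex_of_real (pi ^ Suc n / (4 * fact n)) * poly (euler_poly n) (complex_of_real y)) =
        P * (2 * S a + 2 * S (- a) + D)"
      by (simp add: P_def)
    moreover have "4 * complex_of_real (sin (pi * y - real n * pi / 2)) = 2 * T a + 2 * T (- a)"
    proof -
      have "T a + T (- a) = 2 * complex_of_real (sin (pi * y - real n * pi / 2))"
        using pole_parts_eq_sin [of n y] unfolding a_def [symmetric] T_def .
      then have "2 * (T a + T (- a)) = 2 * (2 * complex_of_real (sin (pi * y - real n * pi / 2)))"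
        by (rule arg_cong)
      then show ?thesis
        by (simp only: distrib_left) simp
    qed
    ultimately have eq: "4 * (complex_of_real (pi ^ Suc n / (4 * fact n)) * poly (euler_poly n) (complex_of_real y)
          - complex_of_real (sin (pi * y - real n * pi / 2)))
        = 2 * (P * S a - T a) + 2 * (P * S (- a) - T (- a)) + P * D"
      by (simp add: algebra_simps)
    have na: "norm a = pi" "norm (- a) = pi"
      by (simp_all add: a_def norm_mult)
    have "norm (P * S a - T a) \<le> poisson_peak (Suc n) / (1 - exp (-1))"
      "norm (P * S (- a) - T (- a)) \<le> poisson_peak (Suc n) / (1 - exp (-1))"
      unfolding P_def S_def T_def using pole_part_asymp [OF na(1) y] pole_part_asymp [OF na(2) y] 
      by (simp_all only: of_real_power)
    moreover have "norm (P * D) \<le> C * l / (l - 1) * pi * exp 1 * poisson_peak (Suc n)"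
      unfolding P_def D_def
      by (rule analytic_part_bound [OF l R_def _ y]) (use C in \<open>simp add: d_def\<close>)
    moreover have "norm (2 * (P * S a - T a) + 2 * (P * S (- a) - T (- a)) + P * D) \<le>
        2 * norm (P * S a - T a) + 2 * norm (P * S (- a) - T (- a)) + norm (P * D)"
      by (intro order.trans [OF norm_triangle_ineq] add_mono) (simp_all only: norm_mult norm_numeral order.refl)
    moreover have "4 * (K * poisson_peak (Suc n)) = 2 * (poisson_peak (Suc n) / (1 - exp (-1)))
          + 2 * (poisson_peak (Suc n) / (1 - exp (-1)))
          + C * l / (l - 1) * pi * exp 1 * poisson_peak (Suc n)"
      by (simp add: K_def distrib_right)
    ultimately have "norm (2 * (P * S a - T a) + 2 * (P * S (- a) - T (- a)) + P * D) \<le>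
        4 * (K * poisson_peak (Suc n))"
      by linarith
    then show "norm (complex_of_real (pi ^ Suc n / (4 * fact n)) * poly (euler_poly n) (complex_of_real y)
        - complex_of_real (sin (pi * y - real n * pi / 2))) \<le> K * poisson_peak (Suc n)"
      unfolding eq [symmetric] norm_mult by simp
  qed
qed

section \<open>Counting zeros of a function close to a sine\<close>

lemma abs_sin_cos_add_int_pi:
  "\<bar>sin (pi * (t + of_int k))\<bar> = \<bar>sin (pi * t)\<bar>" "\<bar>cos (pi * (t + of_int k))\<bar> = \<bar>cos (pi * t)\<bar>"
  by (simp_all add: distrib_left sin_add cos_add cos_npi_int abs_mult)

text \<open>The sine increases on the first quarter period and reaches 1/2 at
  \<open>pi / 6\<close>.\<close>

lemma abs_sin_less_half_imp:
  assumes "\<bar>sin (pi * t)\<bar> < 1 / 2" "\<bar>t\<bar> \<le> 1 / 2"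
  shows "\<bar>t\<bar> < 1 / 6"
proof (rule ccontr)
  assume "\<not> \<bar>t\<bar> < 1 / 6"
  then have "sin (pi / 6) \<le> sin (pi * \<bar>t\<bar>)"
    using assms(2) by (intro sin_monotone_2pi_le) (auto simp: field_simps)
  also have "\<dots> \<le> \<bar>sin (pi * t)\<bar>"
    by (cases "t \<ge> 0") auto
  finally show False
    using assms(1) by (simp add: sin_30)
qed

lemma abs_cos_ge_half:
  assumes "\<bar>t\<bar> < 1 / 6"
  shows "\<bar>cos (pi * t)\<bar> \<ge> 1 / 2"
proof -
  have "cos (pi / 3) \<le> cos (pi * \<bar>t\<bar>)"
    using assms by (intro cos_monotone_0_pi_le) (auto simp: field_simps)
  also have "\<dots> = cos (pi * t)"
    by (cases "t \<ge> 0") auto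
  finally show ?thesis
    by (simp add: cos_60)
qed

text \<open>The comparison sine vanishes at \<open>c\<close> plus the integers. Writing the
  derivative as \<open>pi * g\<close> puts \<open>g\<close> next to the cosine of the same argument.
  Tolerance 1/2 suffices: it confines zeros of \<open>f\<close> to places where the cosine has
  modulus at least 1/2.\<close>

locale near_sine =
  fixes f g :: "real \<Rightarrow> real" and c \<alpha> \<beta> :: real
  assumes deriv: "\<And>y. (f has_real_derivative pi * g y) (at y)"
  assumes near_sin: "\<And>y. \<alpha> \<le> y \<Longrightarrow> y \<le> \<beta> \<Longrightarrow> \<bar>f y - sin (pi * (y - c))\<bar> < 1 / 2"
  assumes near_cos: "\<And>y. \<alpha> \<le> y \<Longrightarrow> y \<le> \<beta> \<Longrightarrow> \<bar>g y - cos (pi * (y - c))\<bar> < 1 / 2"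
begin

definition zeros :: "real set" where
  "zeros = {y. \<alpha> \<le> y \<and> y \<le> \<beta> \<and> f y = 0}"

text \<open>Here \<open>k\<close> is an integer nearest to \<open>y - c\<close>; at a zero of
  \<open>f\<close> the sine itself is below the tolerance.\<close>

lemma near_zero:
  assumes "y \<in> zeros" "k = \<lfloor>y - c + 1 / 2\<rfloor>"
  shows "\<bar>y - c - of_int k\<bar> < 1 / 6"
proof (rule abs_sin_less_half_imp)
  show "\<bar>y - c - of_int k\<bar> \<le> 1 / 2"
    unfolding assms(2) by linarith
  have "\<bar>sin (pi * (y - c))\<bar> < 1 / 2"
    using near_sin [of y] assms(1) by (auto simp: zeros_def)
  then show "\<bar>sin (pi * (y - c - of_int k))\<bar> < 1 / 2"
    using abs_sin_cos_add_int_pi(1) [of "y - c - of_int k" k] by simp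
qed

text \<open>The cosine has modulus at least 1/2 there and \<open>g\<close> is off by less. Arbitrary
  points near \<open>c + k\<close> are allowed because Rolle's theorem supplies one that need not be
  a zero of \<open>f\<close>.\<close>

lemma deriv_nonzero:
  assumes "\<alpha> \<le> y" "y \<le> \<beta>" "\<bar>y - c - of_int k\<bar> < 1 / 6"
  shows "g y \<noteq> 0"
  using near_cos [OF assms(1,2)] abs_cos_ge_half [OF assms(3)]
    abs_sin_cos_add_int_pi(2) [of "y - c - of_int k" k] by auto

lemma zero_simple: "y \<in> zeros \<Longrightarrow> g y \<noteq> 0"
  using deriv_nonzero near_zero by (auto simp: zeros_def)

text \<open>Two zeros with the same nearest integer would enclose a zero of \<open>g\<close> equally
  close to it, against \<open>deriv_nonzero\<close>.\<close>

lemma inj_on_zeros: "inj_on (\<lambda>y. \<lfloor>y - c + 1 / 2\<rfloor>) zeros"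
proof (rule linorder_inj_onI)
  fix x y assume xy: "x < y" "x \<in> zeros" "y \<in> zeros"
  show "\<lfloor>x - c + 1 / 2\<rfloor> \<noteq> \<lfloor>y - c + 1 / 2\<rfloor>"
  proof
    define k where "k = \<lfloor>x - c + 1 / 2\<rfloor>"
    assume "\<lfloor>x - c + 1 / 2\<rfloor> = \<lfloor>y - c + 1 / 2\<rfloor>"
    then have "k = \<lfloor>y - c + 1 / 2\<rfloor>"
      by (simp add: k_def)
    then have k: "\<bar>x - c - of_int k\<bar> < 1 / 6" "\<bar>y - c - of_int k\<bar> < 1 / 6"
      using near_zero [OF xy(2) k_def] near_zero [OF xy(3)] by auto
    obtain z where z: "x < z" "z < y" "pi * g z = 0"
    proof -
      have "\<exists>z. x < z \<and> z < y \<and> (*) (pi * g z) = (\<lambda>v. 0)"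
      proof (rule Rolle_deriv)
        show "x < y" "f x = f y"
          using xy by (auto simp: zeros_def)
        show "continuous_on {x..y} f"
          by (intro continuous_at_imp_continuous_on ballI DERIV_isCont [OF deriv])
        show "(f has_derivative (*) (pi * g z)) (at z)" for z
          using deriv [of z] by (simp add: has_field_derivative_def)
      qed
      then show thesis
        using that by (metis mult_1_right)
    qed
    moreover have "\<bar>z - c - of_int k\<bar> < 1 / 6"
      using k z by linarith
    ultimately show False
      using deriv_nonzero [of z k] xy by (auto simp: zeros_def)
  qed
qed auto

lemma zeros_image: "(\<lambda>y. \<lfloor>y - c + 1 / 2\<rfloor>) ` zeros \<subseteq> {\<lfloor>\<alpha> - c + 1 / 2\<rfloor>..\<lfloor>\<beta> - c + 1 / 2\<rfloor>}"
  by (auto simp: zeros_def intro!: floor_mono)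

lemma finite_zeros: "finite zeros"
  using inj_on_zeros zeros_image finite_imageD finite_subset by blast

lemma card_zeros_le:
  assumes "\<alpha> \<le> \<beta>"
  shows "real (card zeros) \<le> \<beta> - \<alpha> + 2"
proof -
  have "card zeros \<le> card {\<lfloor>\<alpha> - c + 1 / 2\<rfloor>..\<lfloor>\<beta> - c + 1 / 2\<rfloor>}"
    by (rule card_inj_on_le [OF inj_on_zeros zeros_image]) auto
  then have "int (card zeros) \<le> \<lfloor>\<beta> - c + 1 / 2\<rfloor> - \<lfloor>\<alpha> - c + 1 / 2\<rfloor> + 1"
    using floor_mono [of "\<alpha> - c + 1 / 2" "\<beta> - c + 1 / 2"] assms by auto
  then show ?thesis
    by linarith
qed

lemma near_sin_extremum:
  assumes "\<alpha> \<le> y" "y \<le> \<beta>" "y = c + 1 / 2 + of_int k"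
  shows "if even k then f y > 0 else f y < 0"
proof -
  have "pi * (y - c) = pi / 2 + pi * of_int k"
    by (simp add: assms(3) algebra_simps)
  then have sin: "sin (pi * (y - c)) = (if even k then 1 else -1)"
    by (simp add: sin_add cos_npi_int)
  show ?thesis
    using near_sin [OF assms(1,2)] unfolding sin abs_diff_less_iff by (cases "even k") simp_all
qed

lemma card_zeros_ge: "\<beta> - \<alpha> - 2 \<le> real (card zeros)"
proof -
  \<comment> \<open>The indices \<open>k\<close> for which the extrema of the sine at
    \<open>c + 1/2 + k\<close> and \<open>c + 1/2 + k + 1\<close> both lie in the interval;
    \<open>f\<close> changes sign between them.\<close>
  define K where "K = {\<lceil>\<alpha> - c - 1 / 2\<rceil>..<\<lfloor>\<beta> - c - 1 / 2\<rfloor>}"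
  have "K \<subseteq> (\<lambda>y. \<lfloor>y - c - 1 / 2\<rfloor>) ` zeros"
  proof
    fix k assume "k \<in> K"
    define u where "u = c + 1 / 2 + of_int k"
    define v where "v = c + 1 / 2 + of_int (k + 1)"
    have uv: "\<alpha> \<le> u" "u < v" "v \<le> \<beta>"
      using \<open>k \<in> K\<close> unfolding K_def u_def v_def by (auto, linarith+)
    have cont: "continuous_on {u..v} f"
      by (intro continuous_at_imp_continuous_on ballI DERIV_isCont [OF deriv])
    have fu: "if even k then f u > 0 else f u < 0" and fv: "if even k then f v < 0 else f v > 0"
      using near_sin_extremum [OF _ _ u_def] near_sin_extremum [OF _ _ v_def] uv
      by (auto split: if_splits)
    have "\<exists>z\<ge>u. z \<le> v \<and> f z = 0"
    proof (cases "even k")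
      case True
      then show ?thesis
        using IVT2' [of f v 0 u] fu fv uv cont by auto
    next
      case False
      then show ?thesis
        using IVT' [of f u 0 v] fu fv uv cont by auto
    qed
    then obtain z where z: "u \<le> z" "z \<le> v" "f z = 0"
      by auto
    \<comment> \<open>Excluding the right end makes the floor return \<open>k\<close> and not
      \<open>k + 1\<close>, so different steps give different zeros.\<close>
    moreover have "z \<noteq> v"
      using z(3) fv by (auto split: if_splits)
    ultimately have "\<lfloor>z - c - 1 / 2\<rfloor> = k" "z \<in> zeros"
      using uv by (auto simp: u_def v_def zeros_def floor_eq_iff)
    then show "k \<in> (\<lambda>y. \<lfloor>y - c - 1 / 2\<rfloor>) ` zeros"
      by auto
  qed
  then have "card K \<le> card zeros"
    by (rule surj_card_le [OF finite_zeros])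
  then have "\<lfloor>\<beta> - c - 1 / 2\<rfloor> - \<lceil>\<alpha> - c - 1 / 2\<rceil> \<le> int (card zeros)"
    by (simp add: K_def)
  then show ?thesis
    by linarith
qed

end

section \<open>Real Euler polynomials as near-sines\<close>

definition real_euler_poly :: "nat \<Rightarrow> real poly" where
  "real_euler_poly n = map_poly Re (euler_poly n)"

lemma coeff_real_euler_poly: "coeff (real_euler_poly n) j = Re (coeff (euler_poly n) j)"
  by (simp add: real_euler_poly_def coeff_map_poly)

lemma pderiv_real_euler_poly:
  "pderiv (real_euler_poly (Suc n)) = smult (of_nat (Suc n)) (real_euler_poly n)"
proof (rule poly_eqI)
  fix j
  have "coeff (pderiv (real_euler_poly (Suc n))) j = Re (coeff (pderiv (euler_poly (Suc n))) j)"
    by (simp add: coeff_pderiv coeff_real_euler_poly)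
  then show "coeff (pderiv (real_euler_poly (Suc n))) j =
      coeff (smult (of_nat (Suc n)) (real_euler_poly n)) j"
    by (simp add: pderiv_euler_poly coeff_real_euler_poly)
qed

lemma euler_poly_conv_real: "euler_poly n = map_poly of_real (real_euler_poly n)"
proof (rule poly_eqI)
  fix j
  have "fact m \<in> (\<real> :: complex set)" for m
    by (metis Reals_of_nat of_nat_fact)
  then have "coeff (euler_poly n) j \<in> \<real>"
    by (auto simp: coeff_euler_poly euler_coeff_Real intro!: Reals_mult Reals_divide)
  then show "coeff (euler_poly n) j = coeff (map_poly of_real (real_euler_poly n)) j"
    by (simp add: coeff_map_poly coeff_real_euler_poly)
qed

lemma poly_euler_poly_of_real:
  "poly (euler_poly n) (complex_of_real y) = of_real (poly (real_euler_poly n) y)"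
proof -
  have "poly (map_poly of_real p) (complex_of_real y) = of_real (poly p y)" for p
    by (induction p) (auto simp: map_poly_pCons)
  then show ?thesis
    by (simp add: euler_poly_conv_real)
qed

text \<open>The factor gives the limiting sine amplitude 1 and absorbs the \<open>n\<close> in the
  derivative rule, so that consecutive indices form the pair \<open>f\<close>, \<open>g\<close> of
  \<open>near_sine\<close>.\<close>

definition normalized_euler :: "nat \<Rightarrow> real \<Rightarrow> real" where
  "normalized_euler n y = pi ^ Suc n / (4 * fact n) * poly (real_euler_poly n) y"

lemma normalized_euler_eq_0_iff:
  "normalized_euler n y = 0 \<longleftrightarrow> poly (euler_poly n) (complex_of_real y) = 0"
  by (simp add: normalized_euler_def poly_euler_poly_of_real)

lemma normalized_euler_deriv:
  "(normalized_euler (Suc n) has_real_derivative pi * normalized_euler n y) (at y)"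
proof -
  have "(normalized_euler (Suc n) has_real_derivative
      pi ^ Suc (Suc n) / (4 * fact (Suc n)) * poly (pderiv (real_euler_poly (Suc n))) y) (at y)"
    unfolding normalized_euler_def [abs_def] by (intro DERIV_cmult poly_DERIV)
  also have "pi ^ Suc (Suc n) / (4 * fact (Suc n)) * poly (pderiv (real_euler_poly (Suc n))) y
      = pi * normalized_euler n y"
    by (simp add: normalized_euler_def pderiv_real_euler_poly del: of_nat_Suc)
  finally show ?thesis .
qed

lemma normalized_euler_near_sin:
  assumes "e > 0"
  shows "\<forall>\<^sub>F n in sequentially. \<forall>y. \<bar>y\<bar> \<le> real (Suc n) / (pi * exp 1) \<longrightarrow>
           \<bar>normalized_euler n y - sin (pi * y - real n * pi / 2)\<bar> < e"
proof -
  obtain K where K: "\<And>n y. \<bar>y\<bar> \<le> real (Suc n) / (pi * exp 1) \<Longrightarrow>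
    norm (complex_of_real (pi ^ Suc n / (4 * fact n)) * poly (euler_poly n) (complex_of_real y)
      - complex_of_real (sin (pi * y - real n * pi / 2))) \<le> K * poisson_peak (Suc n)"
    using euler_poly_asymp by blast
  have "(\<lambda>n. K * poisson_peak (Suc n)) \<longlonglongrightarrow> K * 0"
    by (intro tendsto_intros LIMSEQ_Suc poisson_peak_tendsto_0)
  then have "\<forall>\<^sub>F n in sequentially. K * poisson_peak (Suc n) < e"
    using assms by (intro order_tendstoD(2)) auto
  then show ?thesis
  proof eventually_elim
    case (elim n)
    have "\<bar>normalized_euler n y - sin (pi * y - real n * pi / 2)\<bar> < e"
      if "\<bar>y\<bar> \<le> real (Suc n) / (pi * exp 1)" for y
    proof -
      have "complex_of_real (normalized_euler n y) =
          complex_of_real (pi ^ Suc n / (4 * fact n)) * poly (euler_poly n) (complex_of_real y)"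
        by (simp add: normalized_euler_def poly_euler_poly_of_real)
      then have "norm (complex_of_real (normalized_euler n y - sin (pi * y - real n * pi / 2)))
          \<le> K * poisson_peak (Suc n)"
        using K [OF that] by simp
      then show ?thesis
        using elim unfolding norm_of_real by linarith
    qed
    then show ?case
      by blast
  qed
qed

text \<open>The derivative of index \<open>Suc n\<close> has index \<open>n\<close>, and its
  estimate holds only up to \<open>Suc n / (pi * e)\<close>. This is exactly the segment of the
  theorem scaled by the degree \<open>Suc n\<close>, so the end points are covered.\<close>

lemma near_sine_normalized_euler:
  "\<forall>\<^sub>F n in sequentially. near_sine (normalized_euler (Suc n)) (normalized_euler n) (real (Suc n) / 2)
     (- (real (Suc n) / (pi * exp 1))) (real (Suc n) / (pi * exp 1))"
proof -
  have ev: "\<forall>\<^sub>F n in sequentially. \<forall>y. \<bar>y\<bar> \<le> real (Suc n) / (pi * exp 1) \<longrightarrow>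
           \<bar>normalized_euler n y - sin (pi * y - real n * pi / 2)\<bar> < 1 / 2"
    by (rule normalized_euler_near_sin) auto
  then have "\<forall>\<^sub>F n in sequentially. \<forall>y. \<bar>y\<bar> \<le> real (Suc (Suc n)) / (pi * exp 1) \<longrightarrow>
           \<bar>normalized_euler (Suc n) y - sin (pi * y - real (Suc n) * pi / 2)\<bar> < 1 / 2"
    by (subst eventually_sequentially_Suc)
  with ev show ?thesis
  proof eventually_elim
    case (elim n)
    show ?case
    proof
      fix y assume "- (real (Suc n) / (pi * exp 1)) \<le> y" "y \<le> real (Suc n) / (pi * exp 1)"
      then have y: "\<bar>y\<bar> \<le> real (Suc n) / (pi * exp 1)"
        by linarith
      also have "\<dots> \<le> real (Suc (Suc n)) / (pi * exp 1)"
        by (intro divide_right_mono) auto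
      finally have y': "\<bar>y\<bar> \<le> real (Suc (Suc n)) / (pi * exp 1)" .
      have "pi * y - real (Suc n) * pi / 2 = pi * (y - real (Suc n) / 2)"
        by (simp add: algebra_simps)
      then show "\<bar>normalized_euler (Suc n) y - sin (pi * (y - real (Suc n) / 2))\<bar> < 1 / 2"
        using elim(2) y' by metis
      have "pi * y - real n * pi / 2 = pi * (y - real (Suc n) / 2) + pi / 2"
        by (simp add: field_simps)
      then have "sin (pi * y - real n * pi / 2) = cos (pi * (y - real (Suc n) / 2))"
        by (simp add: sin_add)
      then show "\<bar>normalized_euler n y - cos (pi * (y - real (Suc n) / 2))\<bar> < 1 / 2"
        using elim(1) y by metis
    qed (rule normalized_euler_deriv)
  qed
qed

section \<open>Zeros of the scaled polynomials and their density\<close>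

lemma scaled_euler_poly_nonzero: "n > 0 \<Longrightarrow> scaled_euler_poly n \<noteq> 0"
  and degree_scaled_euler_poly: "n > 0 \<Longrightarrow> degree (scaled_euler_poly n) = n"
proof -
  assume "n > 0"
  then show deg: "degree (scaled_euler_poly n) = n"
    by (simp add: scaled_euler_poly_def degree_pcompose degree_euler_poly)
  with \<open>n > 0\<close> show "scaled_euler_poly n \<noteq> 0"
    by auto
qed

lemma poly_pderiv_scaled_euler_poly:
  "poly (pderiv (scaled_euler_poly (Suc n))) x =
     of_nat (Suc n) ^ 2 * poly (euler_poly n) (of_nat (Suc n) * x)"
  by (simp add: scaled_euler_poly_def pderiv_pcompose poly_pcompose pderiv_euler_poly pderiv_pCons
        power2_eq_square mult_ac del: of_nat_Suc)

text \<open>A root at which the derivative does not vanish has order 1, so the multiset of roots is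
  a set.\<close>

lemma size_eq_card_if_simple:
  assumes "p \<noteq> 0" "\<And>z. z \<in> S \<Longrightarrow> poly p z = 0 \<Longrightarrow> poly (pderiv p) z \<noteq> 0"
  shows "size (zeros_in p S) = card {z \<in> S. poly p z = 0}"
proof -
  have set: "set_mset (zeros_in p S) = {z \<in> S. poly p z = 0}"
    using assms(1) by (auto simp: zeros_in_def)
  have "count (zeros_in p S) z = 1" if "z \<in> S" "poly p z = 0" for z
    using that assms order_pderiv [of p z] by (simp add: zeros_in_def order_0I)
  then have "size (zeros_in p S) = (\<Sum>z\<in>{z \<in> S. poly p z = 0}. 1)"
    unfolding size_multiset_overloaded_eq set by (intro sum.cong) auto
  then show ?thesis
    by simp
qed

lemma size_zeros_in_bounds:
  assumes near: "near_sine (normalized_euler (Suc n)) (normalized_euler n) (real (Suc n) / 2)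
     (- (real (Suc n) / (pi * exp 1))) (real (Suc n) / (pi * exp 1))"
  assumes ab: "- (1 / (pi * exp 1)) \<le> a" "a < b" "b \<le> 1 / (pi * exp 1)"
  defines "N \<equiv> size (zeros_in (scaled_euler_poly (Suc n)) (complex_of_real ` {a..b}))"
  shows "real (Suc n) * (b - a) - 2 \<le> real N" "real N \<le> real (Suc n) * (b - a) + 2"
proof -
  define m where "m = real (Suc n)"
  have m: "m > 0"
    by (simp add: m_def)
  have "- (m / (pi * exp 1)) \<le> m * a" "m * b \<le> m / (pi * exp 1)"
    using mult_left_mono [OF ab(1), of m] mult_left_mono [OF ab(3), of m] m by auto
  \<comment> \<open>The estimates pass to subintervals, here the image of \<open>[a, b]\<close>
    under \<open>y = m * x\<close>.\<close>
  then interpret near_sine "normalized_euler (Suc n)" "normalized_euler n" "m / 2" "m * a" "m * b"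
    using near unfolding near_sine_def m_def by (meson order.trans)
  have root: "poly (scaled_euler_poly (Suc n)) (complex_of_real x) = 0 \<longleftrightarrow>
      normalized_euler (Suc n) (m * x) = 0" for x
    by (simp add: poly_scaled_euler_poly normalized_euler_eq_0_iff m_def)
  have "N = card {z \<in> complex_of_real ` {a..b}. poly (scaled_euler_poly (Suc n)) z = 0}"
    unfolding N_def
  proof (rule size_eq_card_if_simple)
    fix z assume z: "z \<in> complex_of_real ` {a..b}" "poly (scaled_euler_poly (Suc n)) z = 0"
    then obtain x where x: "z = of_real x" "a \<le> x" "x \<le> b"
      by auto
    have "m * x \<in> zeros"
      using z x root m by (auto simp: zeros_def)
    then have "normalized_euler n (m * x) \<noteq> 0"
      by (rule zero_simple)
    then show "poly (pderiv (scaled_euler_poly (Suc n))) z \<noteq> 0"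
      by (simp add: x poly_pderiv_scaled_euler_poly normalized_euler_eq_0_iff m_def del: of_nat_Suc)
  qed (simp add: scaled_euler_poly_nonzero)
  also have "{z \<in> complex_of_real ` {a..b}. poly (scaled_euler_poly (Suc n)) z = 0} =
      (\<lambda>y. complex_of_real (y / m)) ` zeros"
  proof (intro equalityI subsetI)
    fix z assume "z \<in> {z \<in> complex_of_real ` {a..b}. poly (scaled_euler_poly (Suc n)) z = 0}"
    then obtain x where x: "z = of_real x" "a \<le> x" "x \<le> b" "normalized_euler (Suc n) (m * x) = 0"
      using root by auto
    then have "m * x \<in> zeros" "z = complex_of_real (m * x / m)"
      using m by (auto simp: zeros_def)
    then show "z \<in> (\<lambda>y. complex_of_real (y / m)) ` zeros"
      by blast
  next
    fix z assume "z \<in> (\<lambda>y. complex_of_real (y / m)) ` zeros"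
    then obtain y where y: "y \<in> zeros" "z = complex_of_real (y / m)"
      by auto
    then have "m * a \<le> y" "y \<le> m * b" "normalized_euler (Suc n) y = 0"
      unfolding zeros_def by auto
    then have "y / m \<in> {a..b}" "normalized_euler (Suc n) (m * (y / m)) = 0"
      using m by (auto simp: pos_le_divide_eq pos_divide_le_eq mult.commute)
    then show "z \<in> {z \<in> complex_of_real ` {a..b}. poly (scaled_euler_poly (Suc n)) z = 0}"
      using y(2) root by blast
  qed
  also have "card \<dots> = card zeros"
    using m by (intro card_image inj_onI) auto
  finally have N: "N = card zeros" .
  then show "real (Suc n) * (b - a) - 2 \<le> real N" "real N \<le> real (Suc n) * (b - a) + 2"
    using card_zeros_ge card_zeros_le ab m unfolding N m_def [symmetric]
    by (auto simp: right_diff_distrib)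
qed

lemma zeros_in_density:
  assumes ab: "- (1 / (pi * exp 1)) \<le> a" "a < b" "b \<le> 1 / (pi * exp 1)"
  shows "(\<lambda>n. real (size (zeros_in (scaled_euler_poly n) (complex_of_real ` {a..b}))) / real n)
           \<longlonglongrightarrow> b - a"
\<comment> \<open>The count bounds are for degree \<open>Suc n\<close>, hence the index shift; their
  error 2 vanishes after division by the degree.\<close>
proof (rule LIMSEQ_imp_Suc, rule tendsto_sandwich)
  define N where "N = (\<lambda>n. real (size (zeros_in (scaled_euler_poly (Suc n)) (complex_of_real ` {a..b}))))"
  have "\<forall>\<^sub>F n in sequentially. real (Suc n) * (b - a) - 2 \<le> N n \<and> N n \<le> real (Suc n) * (b - a) + 2"
    using near_sine_normalized_euler
    by eventually_elim (use size_zeros_in_bounds [OF _ ab] in \<open>simp only: N_def\<close>)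
  then have "\<forall>\<^sub>F n in sequentially. (b - a) - 2 / real (Suc n) \<le> N n / real (Suc n) \<and>
      N n / real (Suc n) \<le> (b - a) + 2 / real (Suc n)"
  proof eventually_elim
    case (elim n)
    have "(b - a) - 2 / real (Suc n) = (real (Suc n) * (b - a) - 2) / real (Suc n)"
      "(b - a) + 2 / real (Suc n) = (real (Suc n) * (b - a) + 2) / real (Suc n)"
      by (simp_all add: diff_divide_distrib add_divide_distrib del: of_nat_Suc)
    then show ?case
      using elim by (simp only: divide_right_mono of_nat_0_le_iff)
  qed
  then show "\<forall>\<^sub>F n in sequentially. (b - a) - 2 / real (Suc n) \<le>
        real (size (zeros_in (scaled_euler_poly (Suc n)) (complex_of_real ` {a..b}))) / real (Suc n)"
    "\<forall>\<^sub>F n in sequentially.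
        real (size (zeros_in (scaled_euler_poly (Suc n)) (complex_of_real ` {a..b}))) / real (Suc n)
      \<le> (b - a) + 2 / real (Suc n)"
    unfolding N_def by (auto elim!: eventually_mono)
  have lim: "(\<lambda>n. 2 / real (Suc n)) \<longlonglongrightarrow> 0"
    by (rule LIMSEQ_Suc [OF lim_const_over_n])
  show "(\<lambda>n. (b - a) - 2 / real (Suc n)) \<longlonglongrightarrow> b - a"
    using tendsto_diff [OF tendsto_const lim] by simp
  show "(\<lambda>n. (b - a) + 2 / real (Suc n)) \<longlonglongrightarrow> b - a"
    using tendsto_add [OF tendsto_const lim] by simp
qed

theorem theorem2:
  shows "(\<forall>a b :: real. - (1 / (pi * exp 1)) \<le> a \<longrightarrow> a < b \<longrightarrow> b \<le> 1 / (pi * exp 1) \<longrightarrow>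
            (\<lambda>n. real (size (zeros_in (scaled_euler_poly n) (complex_of_real ` {a..b}))) / real n)
              \<longlonglongrightarrow> b - a) \<and>
         (\<lambda>n. real (size (zeros_in (scaled_euler_poly n)
                 (complex_of_real ` {- (1 / (pi * exp 1))..1 / (pi * exp 1)})))
              / real (size (proots (scaled_euler_poly n))))
           \<longlonglongrightarrow> 2 / (pi * exp 1)"
proof (intro conjI allI impI zeros_in_density)
  let ?r = "1 / (pi * exp 1) :: real"
  let ?N = "\<lambda>n. real (size (zeros_in (scaled_euler_poly n) (complex_of_real ` {- ?r..?r})))"
  have "- ?r < 0" "0 < ?r"
    by simp_all
  then have "(\<lambda>n. ?N n / real n) \<longlonglongrightarrow> ?r - (- ?r)"
    by (intro zeros_in_density) (auto intro: less_trans)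
  \<comment> \<open>Over the complex numbers a polynomial of degree \<open>n\<close> has
    \<open>n\<close> roots with multiplicity, so the fraction of zeros is the density on the whole
    segment.\<close>
  moreover have "\<forall>\<^sub>F n in sequentially. ?N n / real n = ?N n / real (size (proots (scaled_euler_poly n)))"
    using eventually_gt_at_top [of 0]
    by eventually_elim (simp add: size_proots_complex degree_scaled_euler_poly)
  ultimately have "(\<lambda>n. ?N n / real (size (proots (scaled_euler_poly n)))) \<longlonglongrightarrow> ?r - (- ?r)"
    by (rule Lim_transform_eventually)
  then show "(\<lambda>n. ?N n / real (size (proots (scaled_euler_poly n)))) \<longlonglongrightarrow> 2 / (pi * exp 1)"
    by simp
qed

end
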